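(* Let $X$ and $Y$ be Hausdorff topological spaces with $X$ extremally disconnected, and let $\psi$ be a set-valued mapping from $X$ to the nonempty subsets of $Y$ which is either a minimal usco mapping or a minimal perfect mapping. Then $$\overline{\psi^{-1}[U]}=\overline{\psi^{\#}[U]}\subset \psi^{\#}\left[\overline{U}\right]\quad\text{for every open } U\subset Y .$$ In particular, $\psi^{-1}[U]\subset\psi^{\#}\left[\overline{U}\right]$ for every open $U\subset Y$, and therefore $\psi$ is singleton-valued, i.e. $\psi(x)$ is a one-point set for every $x\in X$.
   Context: A space $X$ is extremally disconnected if $\overline{U}$ is open for every open $U\subset X$. A set-valued mapping $\varphi:X\leadsto Y$ assigns to each $x\in X$ a nonempty subset $\varphi(x)\subset Y$. For $B\subset Y$, put $\varphi^{-1}[B]=\{x\in X:\varphi(x)\cap B\neq\varnothing\}$ and $\varphi^{\#}[B]=\{x\in X:\varphi(x)\subset B\}$; for $S\subset X$, put $\varphi[S]=\bigcup_{x\in S}\varphi(x)$. The graph of $\varphi$ is $\Gamma(\varphi)=\{(x,y)\in X\times Y: y\in\varphi(x)\}$. The mapping $\varphi$ is upper semi-continuous (u.s.c.) if $\varphi^{-1}[F]$ is closed in $X$ for every closed $F\subset Y$ (equivalently, $\varphi^{\#}[U]$ is open in $X$ for every open $U\subset Y$). It is usco if it is u.s.c. and every $\varphi(x)$, $x\in X$, is compact. An usco mapping $\varphi$ is perfect if $\varphi[S]$ is closed in $Y$ for every closed $S\subset X$ and $\varphi^{-1}[\{y\}]$ is compact for every $y\in Y$. An usco (respectively, perfect)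 mapping $\psi:X\leadsto Y$ is a minimal usco (respectively, minimal perfect) mapping if $\psi=\eta$ for every usco (respectively, perfect) mapping $\eta:X\leadsto Y$ with $\Gamma(\eta)\subset\Gamma(\psi)$. *)

theory Defs
  imports "HOL-Analysis.Analysis"
begin

definition extremally_disconnected_space :: "'a topology \<Rightarrow> bool" where
  "extremally_disconnected_space X \<longleftrightarrow>
     (\<forall>U. openin X U \<longrightarrow> openin X (X closure_of U))"

text \<open>A set-valued mapping from \<open>X\<close> to \<open>Y\<close> is a function \<open>'a \<Rightarrow> 'b set\<close> of which only the
  values on \<open>topspace X\<close> matter. In particular, \<open>sv_graph\<close> and the preimages below are
  restricted to \<open>topspace X\<close>, and two such mappings count as equal when they agree on
  \<open>topspace X\<close>.\<close>

definition set_valued_map :: "'a topology \<Rightarrow> 'b topology \<Rightarrow> ('a \<Rightarrow> 'b set) \<Rightarrow> bool" where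
  "set_valued_map X Y \<phi> \<longleftrightarrow>
     (\<forall>x\<in>topspace X. \<phi> x \<noteq> {} \<and> \<phi> x \<subseteq> topspace Y)"

definition sv_vimage :: "'a topology \<Rightarrow> ('a \<Rightarrow> 'b set) \<Rightarrow> 'b set \<Rightarrow> 'a set" where
  "sv_vimage X \<phi> B = {x \<in> topspace X. \<phi> x \<inter> B \<noteq> {}}"

text \<open>The small preimage, written \<open>\<phi>\<close> with a superscript sharp in the literature.\<close>

definition sv_sharp :: "'a topology \<Rightarrow> ('a \<Rightarrow> 'b set) \<Rightarrow> 'b set \<Rightarrow> 'a set" where
  "sv_sharp X \<phi> B = {x \<in> topspace X. \<phi> x \<subseteq> B}"

definition sv_image :: "('a \<Rightarrow> 'b set) \<Rightarrow> 'a set \<Rightarrow> 'b set" where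
  "sv_image \<phi> S = (\<Union>x\<in>S. \<phi> x)"

definition sv_graph :: "'a topology \<Rightarrow> ('a \<Rightarrow> 'b set) \<Rightarrow> ('a \<times> 'b) set" where
  "sv_graph X \<phi> = {(x, y). x \<in> topspace X \<and> y \<in> \<phi> x}"

definition sv_eq :: "'a topology \<Rightarrow> ('a \<Rightarrow> 'b set) \<Rightarrow> ('a \<Rightarrow> 'b set) \<Rightarrow> bool" where
  "sv_eq X \<phi> \<eta> \<longleftrightarrow> (\<forall>x\<in>topspace X. \<phi> x = \<eta> x)"

definition upper_semicontinuous_map ::
    "'a topology \<Rightarrow> 'b topology \<Rightarrow> ('a \<Rightarrow> 'b set) \<Rightarrow> bool" where
  "upper_semicontinuous_map X Y \<phi> \<longleftrightarrow>
     set_valued_map X Y \<phi> \<and> (\<forall>F. closedin Y F \<longrightarrow> closedin X (sv_vimage X \<phi> F))"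

definition usco_map :: "'a topology \<Rightarrow> 'b topology \<Rightarrow> ('a \<Rightarrow> 'b set) \<Rightarrow> bool" where
  "usco_map X Y \<phi> \<longleftrightarrow>
     upper_semicontinuous_map X Y \<phi> \<and> (\<forall>x\<in>topspace X. compactin Y (\<phi> x))"

text \<open>As opposed to the single-valued \<open>perfect_map\<close> of the library, \<open>perfect_sv_map\<close> does not
  require surjectivity.\<close>

definition perfect_sv_map :: "'a topology \<Rightarrow> 'b topology \<Rightarrow> ('a \<Rightarrow> 'b set) \<Rightarrow> bool" where
  "perfect_sv_map X Y \<phi> \<longleftrightarrow>
     usco_map X Y \<phi> \<and>
     (\<forall>S. closedin X S \<longrightarrow> closedin Y (sv_image \<phi> S)) \<and>
     (\<forall>y\<in>topspace Y. compactin X (sv_vimage X \<phi> {y}))"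

definition minimal_usco_map :: "'a topology \<Rightarrow> 'b topology \<Rightarrow> ('a \<Rightarrow> 'b set) \<Rightarrow> bool" where
  "minimal_usco_map X Y \<psi> \<longleftrightarrow>
     usco_map X Y \<psi> \<and>
     (\<forall>\<eta>. usco_map X Y \<eta> \<and> sv_graph X \<eta> \<subseteq> sv_graph X \<psi> \<longrightarrow> sv_eq X \<psi> \<eta>)"

definition minimal_perfect_sv_map :: "'a topology \<Rightarrow> 'b topology \<Rightarrow> ('a \<Rightarrow> 'b set) \<Rightarrow> bool" where
  "minimal_perfect_sv_map X Y \<psi> \<longleftrightarrow>
     perfect_sv_map X Y \<psi> \<and>
     (\<forall>\<eta>. perfect_sv_map X Y \<eta> \<and> sv_graph X \<eta> \<subseteq> sv_graph X \<psi> \<longrightarrow> sv_eq X \<psi> \<eta>)"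

end

theory Submission
  imports Defs
begin

text \<open>If an open \<open>W\<close> misses \<open>\<psi>\<^sup>#[U]\<close>, then removing \<open>U\<close> from the values of \<open>\<psi>\<close> over \<open>W\<close> leaves
  nonempty values and yields a smaller usco (perfect) mapping, so minimality forces
  \<open>W\<close> to miss \<open>\<psi>\<^sup>-\<^sup>1[U]\<close> as well; hence \<open>\<psi>\<^sup>-\<^sup>1[U]\<close> lies in the closure of \<open>\<psi>\<^sup>#[U]\<close>. For
  \<open>V = Y - cl U\<close> the disjoint open sets \<open>\<psi>\<^sup>#[U]\<close> and \<open>\<psi>\<^sup>#[V]\<close> have disjoint closures by extremal
  disconnectedness, and the latter closure contains \<open>\<psi>\<^sup>-\<^sup>1[V]\<close>. Singleton values
  follow by separating two points of \<open>\<psi> x\<close>.\<close>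

definition sv_cut :: "('a \<Rightarrow> 'b set) \<Rightarrow> 'a set \<Rightarrow> 'b set \<Rightarrow> 'a \<Rightarrow> 'b set" where
  "sv_cut \<psi> W U = (\<lambda>z. if z \<in> W then \<psi> z - U else \<psi> z)"

lemma sv_graph_cut_subset: "sv_graph X (sv_cut \<psi> W U) \<subseteq> sv_graph X \<psi>"
  by (auto simp: sv_graph_def sv_cut_def split: if_splits)

lemma sv_eq_cut_disjoint:
  assumes "sv_eq X \<psi> (sv_cut \<psi> W U)"
  shows "W \<inter> sv_vimage X \<psi> U = {}"
  using assms by (fastforce simp: sv_eq_def sv_cut_def sv_vimage_def)

text \<open>The first term ranges over all of \<open>X\<close>, not just over \<open>W\<close>: off
  \<open>W\<close> it adds nothing beyond the second term. In this form, if \<open>F\<close> is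
  closed and \<open>U\<close>, \<open>W\<close> are open, both terms are visibly closed for an
  u.s.c. \<open>\<psi>\<close>, although \<open>W\<close> itself need not be closed.\<close>

lemma sv_vimage_cut:
  "sv_vimage X (sv_cut \<psi> W U) F = sv_vimage X \<psi> (F - U) \<union> (sv_vimage X \<psi> F - W)"
  by (auto simp: sv_vimage_def sv_cut_def)

text \<open>Again \<open>S\<close> stands where \<open>S \<inter> W\<close> might be expected, since
  \<open>S\<close> and \<open>S - W\<close> are closed for closed \<open>S\<close> and open
  \<open>W\<close>; the surplus values lie in the second term anyway.\<close>

lemma sv_image_cut:
  "sv_image (sv_cut \<psi> W U) S = (sv_image \<psi> S - U) \<union> sv_image \<psi> (S - W)"
  by (auto simp: sv_image_def sv_cut_def split: if_splits)

text \<open>The last hypothesis keeps the values nonempty: for a point of \<open>W\<close>, the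
  value of \<open>\<psi>\<close> is not contained in \<open>U\<close>, so something survives the
  cut.\<close>

lemma usco_map_cut:
  assumes "usco_map X Y \<psi>" "openin X W" "openin Y U" "W \<inter> sv_sharp X \<psi> U = {}"
  shows "usco_map X Y (sv_cut \<psi> W U)"
proof -
  have usc: "closedin X (sv_vimage X \<psi> F)" if "closedin Y F" for F
    using assms(1) that by (auto simp: usco_map_def upper_semicontinuous_map_def)
  have "set_valued_map X Y (sv_cut \<psi> W U)"
    using assms(1,4)
    by (fastforce simp: usco_map_def upper_semicontinuous_map_def set_valued_map_def
        sv_cut_def sv_sharp_def)
  moreover have "closedin X (sv_vimage X (sv_cut \<psi> W U) F)" if "closedin Y F" for F
    unfolding sv_vimage_cut using that assms(2,3) usc
    by (intro closedin_Un closedin_diff) auto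
  moreover have "compactin Y (sv_cut \<psi> W U x)" if "x \<in> topspace X" for x
  proof -
    have "compactin Y (\<psi> x)"
      using assms(1) that by (auto simp: usco_map_def)
    moreover from this have "compactin Y ((topspace Y - U) \<inter> \<psi> x)"
      using assms(3) by (intro closed_Int_compactin) auto
    moreover have "(topspace Y - U) \<inter> \<psi> x = \<psi> x - U"
      using compactin_subset_topspace[OF \<open>compactin Y (\<psi> x)\<close>] by auto
    ultimately show ?thesis
      by (simp add: sv_cut_def)
  qed
  ultimately show ?thesis
    by (auto simp: usco_map_def upper_semicontinuous_map_def)
qed

lemma perfect_sv_map_cut:
  assumes "t1_space Y" "perfect_sv_map X Y \<psi>" "openin X W" "openin Y U"
    "W \<inter> sv_sharp X \<psi> U = {}"
  shows "perfect_sv_map X Y (sv_cut \<psi> W U)"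
proof -
  have cut: "usco_map X Y (sv_cut \<psi> W U)"
    using assms by (intro usco_map_cut) (auto simp: perfect_sv_map_def)
  have im: "closedin Y (sv_image \<psi> S)" if "closedin X S" for S
    using assms(2) that by (auto simp: perfect_sv_map_def)
  have "closedin Y (sv_image (sv_cut \<psi> W U) S)" if "closedin X S" for S
    unfolding sv_image_cut using that assms(3,4) im
    by (intro closedin_Un closedin_diff) auto
  moreover have "compactin X (sv_vimage X (sv_cut \<psi> W U) {y})" if "y \<in> topspace Y" for y
  proof (rule closed_compactin)
    show "compactin X (sv_vimage X \<psi> {y})"
      using assms(2) that by (auto simp: perfect_sv_map_def)
    show "sv_vimage X (sv_cut \<psi> W U) {y} \<subseteq> sv_vimage X \<psi> {y}"
      by (auto simp: sv_vimage_def sv_cut_def split: if_splits)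
    \<comment> \<open>Closed points make the fibre of the cut closed by upper semi-continuity; it
      then inherits compactness from the larger fibre of \<open>\<psi>\<close>.\<close>
    have "closedin Y {y}"
      using assms(1) that by (simp add: closedin_t1_singleton)
    then show "closedin X (sv_vimage X (sv_cut \<psi> W U) {y})"
      using cut by (simp add: usco_map_def upper_semicontinuous_map_def)
  qed
  ultimately show ?thesis
    using cut by (simp add: perfect_sv_map_def)
qed

lemma openin_sv_sharp:
  assumes "upper_semicontinuous_map X Y \<psi>" "openin Y U"
  shows "openin X (sv_sharp X \<psi> U)"
proof -
  have "closedin X (sv_vimage X \<psi> (topspace Y - U))"
    using assms by (auto simp: upper_semicontinuous_map_def)
  moreover have "sv_sharp X \<psi> U = topspace X - sv_vimage X \<psi> (topspace Y - U)"
    using assms(1)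
    by (fastforce simp: upper_semicontinuous_map_def set_valued_map_def sv_sharp_def sv_vimage_def)
  ultimately show ?thesis
    by auto
qed

lemma minimal_sv_vimage_subset_closure_sharp:
  assumes "t1_space Y" "openin Y U"
    and min: "minimal_usco_map X Y \<psi> \<or> minimal_perfect_sv_map X Y \<psi>"
  shows "sv_vimage X \<psi> U \<subseteq> X closure_of sv_sharp X \<psi> U"
proof -
  \<comment> \<open>This is the largest open set missing \<open>sv_sharp X \<psi> U\<close>, so a
    subset of \<open>X\<close> that misses \<open>W\<close> lies in the closure.\<close>
  define W where "W = topspace X - X closure_of sv_sharp X \<psi> U"
  have W: "openin X W"
    by (auto simp: W_def)
  have "sv_sharp X \<psi> U \<subseteq> X closure_of sv_sharp X \<psi> U"
    by (rule closure_of_subset) (auto simp: sv_sharp_def)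
  then have disj: "W \<inter> sv_sharp X \<psi> U = {}"
    by (auto simp: W_def)
  have "sv_eq X \<psi> (sv_cut \<psi> W U)"
    using min
  proof
    assume "minimal_usco_map X Y \<psi>"
    then show ?thesis
      using usco_map_cut[OF _ W assms(2) disj] sv_graph_cut_subset[of X \<psi> W U]
      unfolding minimal_usco_map_def by blast
  next
    assume "minimal_perfect_sv_map X Y \<psi>"
    then show ?thesis
      using perfect_sv_map_cut[OF assms(1) _ W assms(2) disj] sv_graph_cut_subset[of X \<psi> W U]
      unfolding minimal_perfect_sv_map_def by blast
  qed
  then have "W \<inter> sv_vimage X \<psi> U = {}"
    by (rule sv_eq_cut_disjoint)
  then show ?thesis
    by (auto simp: W_def sv_vimage_def)
qed

text \<open>An open set disjoint from a set is disjoint from its closure. This is applied twice: to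
  the open set \<open>A\<close> against \<open>B\<close>, then to the closure of \<open>B\<close>,
  open by extremal disconnectedness, against \<open>A\<close>.\<close>

lemma extremally_disconnected_disjoint_closures:
  assumes "extremally_disconnected_space X" "openin X A" "openin X B" "A \<inter> B = {}"
  shows "X closure_of A \<inter> X closure_of B = {}"
proof -
  have "A \<inter> X closure_of B = {}"
    using assms(2,4) by (simp add: openin_Int_closure_of_eq_empty)
  moreover have "openin X (X closure_of B)"
    using assms(1,3) by (simp add: extremally_disconnected_space_def)
  ultimately show ?thesis
    using openin_Int_closure_of_eq_empty[of X "X closure_of B" A] by (simp add: Int_commute)
qed

theorem proposition2p2:
  fixes X :: "'a topology" and Y :: "'b topology" and \<psi> :: "'a \<Rightarrow> 'b set"
  assumes "Hausdorff_space X" and "Hausdorff_space Y"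
    and "extremally_disconnected_space X"
    and "set_valued_map X Y \<psi>"
    and "minimal_usco_map X Y \<psi> \<or> minimal_perfect_sv_map X Y \<psi>"
  shows "(\<forall>U. openin Y U \<longrightarrow>
            X closure_of (sv_vimage X \<psi> U) = X closure_of (sv_sharp X \<psi> U) \<and>
            X closure_of (sv_sharp X \<psi> U) \<subseteq> sv_sharp X \<psi> (Y closure_of U)) \<and>
         (\<forall>U. openin Y U \<longrightarrow> sv_vimage X \<psi> U \<subseteq> sv_sharp X \<psi> (Y closure_of U)) \<and>
         (\<forall>x\<in>topspace X. \<exists>y. \<psi> x = {y})"
proof -
  have usc: "upper_semicontinuous_map X Y \<psi>"
    using assms(5) by (auto simp: minimal_usco_map_def minimal_perfect_sv_map_def
        perfect_sv_map_def usco_map_def)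
  note sub = minimal_sv_vimage_subset_closure_sharp
    [OF Hausdorff_imp_t1_space[OF assms(2)] _ assms(5)]
  have eq: "X closure_of sv_vimage X \<psi> U = X closure_of sv_sharp X \<psi> U" if "openin Y U" for U
  proof
    show "X closure_of sv_vimage X \<psi> U \<subseteq> X closure_of sv_sharp X \<psi> U"
      using sub[OF that] by (simp add: closure_of_minimal)
    have "sv_sharp X \<psi> U \<subseteq> sv_vimage X \<psi> U"
      using assms(4) by (fastforce simp: set_valued_map_def sv_sharp_def sv_vimage_def)
    then show "X closure_of sv_sharp X \<psi> U \<subseteq> X closure_of sv_vimage X \<psi> U"
      by (rule closure_of_mono)
  qed
  have cl: "X closure_of sv_sharp X \<psi> U \<subseteq> sv_sharp X \<psi> (Y closure_of U)" if U: "openin Y U" for U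
  proof -
    define V where "V = topspace Y - Y closure_of U"
    have V: "openin Y V"
      by (auto simp: V_def)
    have "U \<inter> V = {}"
      using closure_of_subset[OF openin_subset[OF U]] by (auto simp: V_def)
    \<comment> \<open>A nonempty value cannot lie in both \<open>U\<close> and
      \<open>V\<close>.\<close>
    then have "sv_sharp X \<psi> U \<inter> sv_sharp X \<psi> V = {}"
      using assms(4) by (fastforce simp: set_valued_map_def sv_sharp_def)
    then have "X closure_of sv_sharp X \<psi> U \<inter> X closure_of sv_sharp X \<psi> V = {}"
      using assms(3) openin_sv_sharp[OF usc] U V
      by (intro extremally_disconnected_disjoint_closures)
    then have "X closure_of sv_sharp X \<psi> U \<inter> sv_vimage X \<psi> V = {}"
      using sub[OF V] by auto
    moreover have "topspace X - sv_vimage X \<psi> V \<subseteq> sv_sharp X \<psi> (Y closure_of U)"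
      using assms(4) by (fastforce simp: set_valued_map_def sv_vimage_def sv_sharp_def V_def)
    ultimately show ?thesis
      using closure_of_subset_topspace[of X "sv_sharp X \<psi> U"] by auto
  qed
  have vim: "sv_vimage X \<psi> U \<subseteq> sv_sharp X \<psi> (Y closure_of U)" if "openin Y U" for U
    using sub[OF that] cl[OF that] by blast
  have "\<exists>y. \<psi> x = {y}" if x: "x \<in> topspace X" for x
  proof -
    have ne: "\<psi> x \<noteq> {}" "\<psi> x \<subseteq> topspace Y"
      using assms(4) x by (auto simp: set_valued_map_def)
    have "y = z" if yz: "y \<in> \<psi> x" "z \<in> \<psi> x" for y z
    proof (rule ccontr)
      assume "y \<noteq> z"
      then obtain U V where UV: "openin Y U" "openin Y V" "y \<in> U" "z \<in> V" "disjnt U V"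
        using assms(2) ne(2) yz unfolding Hausdorff_space_def by (meson subsetD)
      \<comment> \<open>Since \<open>\<psi> x\<close> meets \<open>U\<close> at \<open>y\<close>,
        all of \<open>\<psi> x\<close> lies in the closure of \<open>U\<close>, including
        \<open>z\<close>; but the neighbourhood \<open>V\<close> of \<open>z\<close> misses
        \<open>U\<close>.\<close>
      have "x \<in> sv_vimage X \<psi> U"
        using x yz(1) UV(3) by (auto simp: sv_vimage_def)
      then have "z \<in> Y closure_of U"
        using vim[OF UV(1)] yz(2) by (auto simp: sv_sharp_def)
      moreover have "V \<inter> Y closure_of U = {}"
        using UV(2,5) by (simp add: openin_Int_closure_of_eq_empty disjnt_def Int_commute)
      ultimately show False
        using UV(4) by auto
    qed
    then show ?thesis
      using ne(1) by blast
  qed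
  then show ?thesis
    using eq cl vim by blast
qed

end
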